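(* Let $T$ be an operator on a locally convex Hausdorff space $E$. Then: (i) if $T$ is power bounded, then it is $M_p$-bounded for every $p\in\mathbb{R}$; (ii) $T$ is power bounded if and only if it is $M_{\exp}$-bounded.
   Context: Spaces are over $\mathbb{C}$; an operator on $E$ is a continuous linear map $E\to E$, and $T^0=\mathrm{Id}$. $T$ is power bounded if $\{T^n\}_{n\ge0}$ is equicontinuous, i.e. for every continuous seminorm $r$ there is a continuous seminorm $q$ with $r(T^n x)\le q(x)$ for all $x\in E$, $n\ge 0$. For $p\in\mathbb{R}$ and $n\ge1$ let $S(n,p)=\sum_{i=1}^n i^p$, and let $M_p$ be the infinite lower triangular matrix (rows and columns indexed from $1$) with entries $i^p/S(n,p)$ for $1\le i\le n$ and $0$ for $i>n$. Let $S(n,\exp)=\sum_{i=1}^n e^i$, and let $M_{\exp}$ have entries $e^i/S(n,\exp)$ for $1\le i\le n$ and $0$ for $i>n$. Column $i$ is applied to $T^{i-1}$, so $$(M_pT)_n=\frac1{S(n,p)}\sum_{k=1}^n k^pT^{k-1},\qquad (M_{\exp}T)_n=\frac1{S(n,\exp)}\sum_{k=1}^n e^kT^{k-1}\qquad(n\ge1).$$ For $M\in\{M_p,M_{\exp}\}$, $T$ is $M$-bounded if for every continuous seminorm $r$ on $E$ there is a continuous seminorm $q$ on $E$ with $r((MT)_nx)\le q(x)$ for all $x\in E$, $n\ge1$. *)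

theory Defs
  imports "HOL-Analysis.Analysis"
begin

text \<open>
  The type is the whole space: its classes give a Hausdorff topological abelian group, and
  the locale adds the complex scalar multiplication, its joint continuity, and a
  neighbourhood base of convex sets at the origin.
\<close>

locale locally_convex_hausdorff = vector_space smul
  for smul :: "complex \<Rightarrow> 'a :: {topological_ab_group_add, t2_space} \<Rightarrow> 'a" +
  assumes continuous_scale: "continuous_on UNIV (\<lambda>(c, x). smul c x)"
    and locally_convex:
      "\<lbrakk>open U; 0 \<in> U\<rbrakk> \<Longrightarrow>
        \<exists>V W. open W \<and> 0 \<in> W \<and> W \<subseteq> V \<and> V \<subseteq> U \<and>
          (\<forall>x\<in>V. \<forall>y\<in>V. \<forall>u v :: real. 0 \<le> u \<longrightarrow> 0 \<le> v \<longrightarrow> u + v = 1 \<longrightarrow>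
             smul (complex_of_real u) x + smul (complex_of_real v) y \<in> V)"

definition continuous_seminorm ::
    "(complex \<Rightarrow> 'a :: topological_ab_group_add \<Rightarrow> 'a) \<Rightarrow> ('a \<Rightarrow> real) \<Rightarrow> bool" where
  "continuous_seminorm smul r \<longleftrightarrow>
     (\<forall>x. 0 \<le> r x) \<and>
     (\<forall>x y. r (x + y) \<le> r x + r y) \<and>
     (\<forall>c x. r (smul c x) = cmod c * r x) \<and>
     continuous_on UNIV r"

definition is_operator ::
    "(complex \<Rightarrow> 'a :: topological_ab_group_add \<Rightarrow> 'a) \<Rightarrow> ('a \<Rightarrow> 'a) \<Rightarrow> bool" where
  "is_operator smul T \<longleftrightarrow> Vector_Spaces.linear smul smul T \<and> continuous_on UNIV T"

definition power_bounded ::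
    "(complex \<Rightarrow> 'a :: topological_ab_group_add \<Rightarrow> 'a) \<Rightarrow> ('a \<Rightarrow> 'a) \<Rightarrow> bool" where
  "power_bounded smul T \<longleftrightarrow>
     (\<forall>r. continuous_seminorm smul r \<longrightarrow>
       (\<exists>q. continuous_seminorm smul q \<and> (\<forall>x n. r ((T ^^ n) x) \<le> q x)))"

text \<open>
  Infinite lower triangular matrices are functions \<open>M n i\<close> of the row \<open>n\<close> and the column
  \<open>i\<close>, both counted from 1; index 0 is never used.
\<close>

definition S_pow :: "nat \<Rightarrow> real \<Rightarrow> real" where
  "S_pow n p = (\<Sum>i=1..n. real i powr p)"

definition M_pow :: "real \<Rightarrow> nat \<Rightarrow> nat \<Rightarrow> real" where
  "M_pow p n i = (if 1 \<le> i \<and> i \<le> n then real i powr p / S_pow n p else 0)"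

definition S_exp :: "nat \<Rightarrow> real" where
  "S_exp n = (\<Sum>i=1..n. exp (real i))"

definition M_exp :: "nat \<Rightarrow> nat \<Rightarrow> real" where
  "M_exp n i = (if 1 \<le> i \<and> i \<le> n then exp (real i) / S_exp n else 0)"

text \<open>Row \<open>n\<close> of a lower triangular matrix vanishes beyond column \<open>n\<close>, so the sum stops there.\<close>

definition matrix_action ::
    "(complex \<Rightarrow> 'a :: topological_ab_group_add \<Rightarrow> 'a) \<Rightarrow> (nat \<Rightarrow> nat \<Rightarrow> real) \<Rightarrow>
     ('a \<Rightarrow> 'a) \<Rightarrow> nat \<Rightarrow> 'a \<Rightarrow> 'a" where
  "matrix_action smul M T n x =
     (\<Sum>k=1..n. smul (complex_of_real (M n k)) ((T ^^ (k - 1)) x))"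

definition matrix_bounded ::
    "(complex \<Rightarrow> 'a :: topological_ab_group_add \<Rightarrow> 'a) \<Rightarrow> (nat \<Rightarrow> nat \<Rightarrow> real) \<Rightarrow>
     ('a \<Rightarrow> 'a) \<Rightarrow> bool" where
  "matrix_bounded smul M T \<longleftrightarrow>
     (\<forall>r. continuous_seminorm smul r \<longrightarrow>
       (\<exists>q. continuous_seminorm smul q \<and>
         (\<forall>x. \<forall>n\<ge>1. r (matrix_action smul M T n x) \<le> q x)))"

end

theory Submission
  imports Defs
begin

text \<open>
  Both matrices are Riesz means: row \<open>n\<close> averages the powers of \<open>T\<close> with weights
  \<open>w 1, \<dots>, w n\<close>, divided by the partial sum \<open>S n = w 1 + \<dots> + w n\<close>. When the weights are positive
  the rows are convex combinations, so a seminorm bound on all powers is inherited by all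
  means (lemma \<open>power_bounded_imp_matrix_bounded\<close>).

  A power of \<open>T\<close> is recovered from two consecutive means \<open>A n\<close> by differencing:
  \<open>w (n + 1) * T ^ n = S (n + 1) * A (n + 1) - S n * A n\<close>.
  This inverts the averaging boundedly as soon as \<open>S n \<le> C * w n\<close> for all \<open>n\<close>, that is, when
  the last weight carries a fixed fraction of the total mass (lemma
  \<open>riesz_mean_bounded_imp_power_bounded\<close>). Geometric weights \<open>exp n\<close> have this property with
  \<open>C = 2\<close>; the weights \<open>n powr p\<close> have it for no \<open>p\<close> and no \<open>C\<close>.
\<close>

definition riesz_mean :: "(nat \<Rightarrow> real) \<Rightarrow> nat \<Rightarrow> nat \<Rightarrow> real" where
  "riesz_mean w n i = (if 1 \<le> i \<and> i \<le> n then w i / (\<Sum>j=1..n. w j) else 0)"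

lemma M_pow_eq_riesz_mean: "M_pow p = riesz_mean (\<lambda>i. real i powr p)"
  by (simp add: fun_eq_iff M_pow_def riesz_mean_def S_pow_def)

lemma M_exp_eq_riesz_mean: "M_exp = riesz_mean (\<lambda>i. exp (real i))"
  by (simp add: fun_eq_iff M_exp_def riesz_mean_def S_exp_def)

lemma sum_weights_pos:
  fixes w :: "nat \<Rightarrow> real"
  assumes "\<And>i. 1 \<le> i \<Longrightarrow> 0 < w i" and "1 \<le> n"
  shows "0 < (\<Sum>j=1..n. w j)"
  using assms by (intro sum_pos) auto

lemma riesz_mean_row_sum:
  assumes pos: "\<And>i. 1 \<le> i \<Longrightarrow> 0 < w i" and n: "1 \<le> n"
  shows "(\<Sum>k=1..n. \<bar>riesz_mean w n k\<bar>) = 1"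
proof -
  let ?S = "\<Sum>j=1..n. w j"
  have S: "0 < ?S"
    using pos n by (rule sum_weights_pos)
  have "(\<Sum>k=1..n. \<bar>riesz_mean w n k\<bar>) = (\<Sum>k=1..n. w k / ?S)"
  proof (rule sum.cong[OF refl])
    fix k assume "k \<in> {1..n}"
    then show "\<bar>riesz_mean w n k\<bar> = w k / ?S"
      using S pos[of k] by (simp add: riesz_mean_def)
  qed
  also have "\<dots> = 1"
    using S by (simp add: sum_divide_distrib[symmetric])
  finally show ?thesis .
qed

lemma continuous_seminorm_zero:
  assumes "vector_space smul" and "continuous_seminorm smul r"
  shows "r 0 = 0"
proof -
  interpret vector_space smul by fact
  have "r (smul 0 0) = cmod 0 * r 0"
    using assms(2) unfolding continuous_seminorm_def by blast
  then show ?thesis by simp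
qed

lemma continuous_seminorm_diff:
  assumes "vector_space smul" and "continuous_seminorm smul r"
  shows "r (x - y) \<le> r x + r y"
proof -
  interpret vector_space smul by fact
  have "r (smul (- 1) y) = cmod (- 1) * r y"
    using assms(2) unfolding continuous_seminorm_def by blast
  then have "r (- y) = r y" by simp
  moreover have "r (x + - y) \<le> r x + r (- y)"
    using assms(2) unfolding continuous_seminorm_def by blast
  ultimately show ?thesis by simp
qed

lemma continuous_seminorm_sum:
  assumes "vector_space smul" and r: "continuous_seminorm smul r"
  shows "r (\<Sum>i\<in>A. f i) \<le> (\<Sum>i\<in>A. r (f i))"
proof (induction A rule: infinite_finite_induct)
  case (insert a A)
  have "r (f a + (\<Sum>i\<in>A. f i)) \<le> r (f a) + r (\<Sum>i\<in>A. f i)"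
    using r unfolding continuous_seminorm_def by blast
  then show ?case using insert by simp
qed (simp_all add: continuous_seminorm_zero[OF assms])

lemma continuous_seminorm_mult:
  assumes "continuous_seminorm smul q" and "0 \<le> C"
  shows "continuous_seminorm smul (\<lambda>x. C * q x)"
proof -
  have "C * q (x + y) \<le> C * q x + C * q y" for x y
    using assms mult_left_mono[of "q (x + y)" "q x + q y" C]
    unfolding continuous_seminorm_def by (simp add: distrib_left)
  then show ?thesis
    using assms unfolding continuous_seminorm_def
    by (auto intro!: continuous_intros)
qed

lemma power_bounded_imp_matrix_bounded:
  assumes vs: "vector_space smul" and pb: "power_bounded smul T"
    and rows: "\<And>n. 1 \<le> n \<Longrightarrow> (\<Sum>k=1..n. \<bar>M n k\<bar>) \<le> 1"
  shows "matrix_bounded smul M T"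
  unfolding matrix_bounded_def
proof (intro allI impI)
  fix r assume r: "continuous_seminorm smul r"
  obtain q where q: "continuous_seminorm smul q" "\<And>x n. r ((T ^^ n) x) \<le> q x"
    using pb r unfolding power_bounded_def by blast
  have "r (matrix_action smul M T n x) \<le> q x" if n: "1 \<le> n" for x n
  proof -
    have "r (matrix_action smul M T n x)
        \<le> (\<Sum>k=1..n. r (smul (complex_of_real (M n k)) ((T ^^ (k - 1)) x)))"
      unfolding matrix_action_def by (rule continuous_seminorm_sum[OF vs r])
    also have "\<dots> = (\<Sum>k=1..n. \<bar>M n k\<bar> * r ((T ^^ (k - 1)) x))"
      using r unfolding continuous_seminorm_def by (intro sum.cong) auto
    also have "\<dots> \<le> (\<Sum>k=1..n. \<bar>M n k\<bar> * q x)"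
      by (intro sum_mono mult_left_mono q) auto
    also have "\<dots> = (\<Sum>k=1..n. \<bar>M n k\<bar>) * q x"
      by (simp add: sum_distrib_right)
    also have "\<dots> \<le> 1 * q x"
      using rows[OF n] q(1) unfolding continuous_seminorm_def
      by (intro mult_right_mono) auto
    finally show ?thesis by simp
  qed
  then show "\<exists>q. continuous_seminorm smul q \<and>
      (\<forall>x. \<forall>n\<ge>1. r (matrix_action smul M T n x) \<le> q x)"
    using q(1) by blast
qed

lemma weighted_sum_eq_riesz_mean:
  assumes vs: "vector_space smul"
    and pos: "\<And>i. 1 \<le> i \<Longrightarrow> 0 < w i" and n: "1 \<le> n"
  shows "(\<Sum>k=1..n. smul (complex_of_real (w k)) ((T ^^ (k - 1)) x)) =
    smul (complex_of_real (\<Sum>j=1..n. w j)) (matrix_action smul (riesz_mean w) T n x)"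
proof -
  interpret vector_space smul by fact
  let ?S = "\<Sum>j=1..n. w j"
  have S: "0 < ?S"
    using pos n by (rule sum_weights_pos)
  have "smul (complex_of_real (w k)) y =
      smul (complex_of_real ?S) (smul (complex_of_real (riesz_mean w n k)) y)"
    if "k \<in> {1..n}" for k y
  proof -
    have "w k = ?S * riesz_mean w n k"
      using S that by (simp add: riesz_mean_def)
    then show ?thesis
      by (metis scale_scale of_real_mult)
  qed
  then show ?thesis
    unfolding matrix_action_def scale_sum_right by (intro sum.cong) auto
qed

text \<open>
  The difference of two consecutive weighted sums isolates a single power of \<open>T\<close>. The
  domination \<open>S n \<le> C * w n\<close> keeps the two coefficients \<open>S (n + 1) / w (n + 1)\<close> and
  \<open>S n / w (n + 1)\<close> at most \<open>C\<close>, so the bound for the means is lost only by a factor \<open>2 * C\<close>.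
\<close>

lemma riesz_mean_bounded_imp_power_bounded:
  assumes vs: "vector_space smul" and mb: "matrix_bounded smul (riesz_mean w) T"
    and pos: "\<And>i. 1 \<le> i \<Longrightarrow> 0 < w i"
    and dom: "\<And>n. 1 \<le> n \<Longrightarrow> (\<Sum>j=1..n. w j) \<le> C * w n"
  shows "power_bounded smul T"
  unfolding power_bounded_def
proof (intro allI impI)
  fix r assume r: "continuous_seminorm smul r"
  obtain q where q: "continuous_seminorm smul q"
    and bound: "\<And>x n. 1 \<le> n \<Longrightarrow> r (matrix_action smul (riesz_mean w) T n x) \<le> q x"
    using mb r unfolding matrix_bounded_def by blast
  have q_nonneg: "0 \<le> q x" for x
    using q unfolding continuous_seminorm_def by blast
  have r_scale: "r (smul (complex_of_real a) x) = a * r x" if "0 \<le> a" for a x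
    using r that unfolding continuous_seminorm_def by simp
  let ?S = "\<lambda>n. \<Sum>j=1..n. w j"
  let ?B = "\<lambda>n x. \<Sum>k=1..n. smul (complex_of_real (w k)) ((T ^^ (k - 1)) x)"
  have B: "r (?B n x) \<le> ?S n * q x" for n x
  proof (cases "1 \<le> n")
    case True
    have "0 < ?S n"
      using pos True by (rule sum_weights_pos)
    moreover have "?B n x =
        smul (complex_of_real (?S n)) (matrix_action smul (riesz_mean w) T n x)"
      using vs pos True by (rule weighted_sum_eq_riesz_mean)
    ultimately show ?thesis
      using bound[OF True, of x] by (simp only: r_scale less_imp_le mult_left_mono)
  next
    \<comment> \<open>The empty sum covers the power \<open>T ^ 0\<close>, which has no preceding mean.\<close>
    case False
    then show ?thesis by (simp add: continuous_seminorm_zero[OF vs r])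
  qed
  have "r ((T ^^ n) x) \<le> (2 * C) * q x" for x n
  proof -
    have w: "0 < w (Suc n)" using pos by simp
    have "w (Suc n) * r ((T ^^ n) x) = r (smul (complex_of_real (w (Suc n))) ((T ^^ n) x))"
      using w by (simp add: r_scale)
    also have "\<dots> = r (?B (Suc n) x - ?B n x)"
      by simp
    also have "\<dots> \<le> r (?B (Suc n) x) + r (?B n x)"
      by (rule continuous_seminorm_diff[OF vs r])
    also have "\<dots> \<le> ?S (Suc n) * q x + ?S n * q x"
      by (intro add_mono B)
    also have "\<dots> \<le> ?S (Suc n) * q x + ?S (Suc n) * q x"
      using w q_nonneg by (intro add_left_mono mult_right_mono) auto
    also have "\<dots> \<le> (C * w (Suc n)) * q x + (C * w (Suc n)) * q x"
      using dom[of "Suc n"] q_nonneg by (intro add_mono mult_right_mono) auto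
    also have "\<dots> = w (Suc n) * ((2 * C) * q x)"
      by (simp add: algebra_simps)
    finally show ?thesis using w by simp
  qed
  moreover have "0 \<le> 2 * C"
  proof -
    have "0 < C * w 1"
      using dom[of 1] pos[of 1] by simp
    then show ?thesis using pos[of 1] by (simp add: zero_less_mult_iff)
  qed
  ultimately show "\<exists>q. continuous_seminorm smul q \<and> (\<forall>x n. r ((T ^^ n) x) \<le> q x)"
    using continuous_seminorm_mult[OF q] by blast
qed

lemma sum_exp_le: "(\<Sum>j=1..n. exp (real j)) \<le> 2 * exp (real n)"
proof (induction n)
  case (Suc n)
  \<comment> \<open>The constant 2 reproduces itself because \<open>exp 1 \<ge> 2\<close>.\<close>
  have "2 * exp (real n) \<le> exp 1 * exp (real n)"
    using exp_ge_add_one_self[of 1] by (intro mult_right_mono) auto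
  then have "2 * exp (real n) \<le> exp (real (Suc n))"
    by (simp add: exp_add[symmetric])
  then show ?case using Suc by simp
qed simp

theorem proposition5p4:
  fixes smul :: "complex \<Rightarrow> 'a :: {topological_ab_group_add, t2_space} \<Rightarrow> 'a"
    and T :: "'a \<Rightarrow> 'a"
  assumes "locally_convex_hausdorff smul"
    and "is_operator smul T"
  shows "(power_bounded smul T \<longrightarrow> (\<forall>p::real. matrix_bounded smul (M_pow p) T)) \<and>
         (power_bounded smul T \<longleftrightarrow> matrix_bounded smul M_exp T)"
proof -
  have vs: "vector_space smul"
    using assms(1) by (simp add: locally_convex_hausdorff_def)
  have averaging: "matrix_bounded smul (riesz_mean w) T"
    if "power_bounded smul T" and "\<And>i. 1 \<le> i \<Longrightarrow> 0 < w i" for w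
    using vs that(1)
    by (rule power_bounded_imp_matrix_bounded) (use riesz_mean_row_sum[OF that(2)] in force)
  have "power_bounded smul T" if "matrix_bounded smul M_exp T"
    using vs that[unfolded M_exp_eq_riesz_mean]
    by (rule riesz_mean_bounded_imp_power_bounded[where C = 2])
      (simp_all only: exp_gt_zero sum_exp_le)
  then show ?thesis
    by (auto simp: M_pow_eq_riesz_mean M_exp_eq_riesz_mean intro!: averaging)
qed

end
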